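(* Let $A\in\mathbb{R}^{n\times n}$ be invertible, $b\in\mathbb{R}^n$, $Y=A^{-1}(X-b)$, and $F(y)=f(Ay+b)$. Then $$d^\star(F;Y)=d^\star(f;X).$$
   Context: $X\subset\mathbb{R}^n$ is compact and full dimensional (its affine hull is $\mathbb{R}^n$), $\widehat X=\operatorname{conv}X$, and $f$ is a real-valued $C^2$ function on an open neighborhood of $\widehat X$. $\mathcal{D}^2(f;X)$ is the set of pairs $(g,h)$ of functions that are $C^2$ on a neighborhood of $\widehat X$, satisfy $f=g-h$ there, and are convex on $\widehat X$ (equivalently, have positive semidefinite Hessians at every point of $\widehat X$). For a $C^2$ convex $g$: $V_X(g)=\operatorname{span}\bigl(\bigcup_{z\in\widehat X}\operatorname{range}\nabla^2g(z)\bigr)$ and $d_X(g)=\dim V_X(g)$. The optimal dimension is $d^\star(f;X)=\min_{(g,h)\in\mathcal{D}^2(f;X)}d_X(g)$. The quantity $d^\star(F;Y)$ is defined in the same way with $(F,Y)$ in place of $(f,X)$. *)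

theory Defs
  imports "HOL-Analysis.Analysis"
begin

definition gradient :: "(real^'n \<Rightarrow> real) \<Rightarrow> real^'n \<Rightarrow> real^'n" where
  "gradient f x = (\<chi> i. frechet_derivative f (at x) (axis i 1))"

definition hessian :: "(real^'n \<Rightarrow> real) \<Rightarrow> real^'n \<Rightarrow> real^'n^'n" where
  "hessian f x = jacobian (gradient f) (at x)"

definition C2_on :: "(real^'n \<Rightarrow> real) \<Rightarrow> (real^'n) set \<Rightarrow> bool" where
  "C2_on f U \<longleftrightarrow> open U \<and> f differentiable_on U \<and> gradient f differentiable_on U
     \<and> continuous_on U (hessian f)"

(* Functions are total in HOL, so "defined on a neighbourhood of the hull" means that only the
   values on some open U containing the hull matter. One U serves for g, h and the identity
   f = g - h, since neighbourhoods can be intersected. *)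
definition DC2 :: "(real^'n \<Rightarrow> real) \<Rightarrow> (real^'n) set
    \<Rightarrow> ((real^'n \<Rightarrow> real) \<times> (real^'n \<Rightarrow> real)) set" where
  "DC2 f X = {(g, h).
     (\<exists>U. open U \<and> convex hull X \<subseteq> U \<and> C2_on g U \<and> C2_on h U \<and> (\<forall>x\<in>U. f x = g x - h x))
     \<and> convex_on (convex hull X) g \<and> convex_on (convex hull X) h}"

definition V_space :: "(real^'n) set \<Rightarrow> (real^'n \<Rightarrow> real) \<Rightarrow> (real^'n) set" where
  "V_space X g = span (\<Union>z\<in>convex hull X. range (\<lambda>v. hessian g z *v v))"

definition d_dim :: "(real^'n) set \<Rightarrow> (real^'n \<Rightarrow> real) \<Rightarrow> nat" where
  "d_dim X g = dim (V_space X g)"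

(* A minimum over a set of naturals; for X compact and f of class C2 near its hull the set
   is nonempty, since (f + c |x|^2, c |x|^2) is in DC2 f X for large c. *)
definition d_star :: "(real^'n \<Rightarrow> real) \<Rightarrow> (real^'n) set \<Rightarrow> nat" where
  "d_star f X = (LEAST k. \<exists>(g, h)\<in>DC2 f X. k = d_dim X g)"

end

theory Submission
  imports Defs
begin

text \<open>Precomposition with the affine map \<open>T y = A y + b\<close> carries decompositions of \<open>f\<close> over
  \<open>X = T ` Y\<close> to decompositions of \<open>f \<circ> T\<close> over \<open>Y\<close>. By the chain rule it turns Hessians \<open>H\<close> into
  \<open>A\<^sup>T H A\<close>, so it maps the Hessian range space by the injective map \<open>A\<^sup>T\<close> and preserves its
  dimension. Applying the same to \<open>T\<^sup>-\<^sup>1\<close> shows that the attainable dimensions coincide.\<close>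

text \<open>\<open>gradient\<close> records the derivative on the standard basis only; linearity
  recovers it in every direction, which puts the chain rule in inner product form.\<close>

lemma frechet_derivative_eq_gradient_inner:
  assumes "f differentiable (at x)"
  shows "frechet_derivative f (at x) v = gradient f x \<bullet> v"
proof -
  have lin: "linear (frechet_derivative f (at x))"
    using assms by (simp add: linear_frechet_derivative)
  have "frechet_derivative f (at x) v = frechet_derivative f (at x) (\<Sum>i\<in>UNIV. v $ i *\<^sub>R axis i 1)"
    using basis_expansion[of v] by (simp add: scalar_mult_eq_scaleR)
  also have "\<dots> = (\<Sum>i\<in>UNIV. v $ i * frechet_derivative f (at x) (axis i 1))"
    by (simp add: linear_sum[OF lin] linear_cmul[OF lin])
  also have "\<dots> = gradient f x \<bullet> v"
    by (simp add: gradient_def inner_vec_def mult.commute)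
  finally show ?thesis .
qed

lemma has_derivative_affine_map:
  fixes A :: "real^'n^'m"
  shows "((\<lambda>y. A *v y + b) has_derivative (\<lambda>v. A *v v)) (at y)"
  by (rule derivative_eq_intros bounded_linear.has_derivative[OF matrix_vector_mul_bounded_linear] refl)+ simp

text \<open>The codomain of \<open>f\<close> is left general: the lemma is applied to a scalar
  function and also to its gradient.\<close>

lemma has_derivative_affine_comp:
  fixes A :: "real^'n^'m"
  assumes "f differentiable (at (A *v y + b))"
  shows "((\<lambda>y. f (A *v y + b)) has_derivative
    (\<lambda>v. frechet_derivative f (at (A *v y + b)) (A *v v))) (at y)"
  using diff_chain_at[OF has_derivative_affine_map, of f] assms
  by (fastforce simp: o_def frechet_derivative_works)

lemma gradient_affine_comp:
  fixes A :: "real^'n^'n"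
  assumes "f differentiable (at (A *v y + b))"
  shows "gradient (\<lambda>y. f (A *v y + b)) y = transpose A *v gradient f (A *v y + b)"
proof -
  \<comment> \<open>The chain rule gives the inner product of the gradient at the image point with
    \<open>A *v v\<close>; moving \<open>A\<close> to the other side makes it a transpose.\<close>
  have "frechet_derivative (\<lambda>y. f (A *v y + b)) (at y) v = (transpose A *v gradient f (A *v y + b)) \<bullet> v" for v
    using frechet_derivative_at[OF has_derivative_affine_comp[OF assms]]
      frechet_derivative_eq_gradient_inner[OF assms]
    by (metis dot_lmul_matrix transpose_matrix_vector)
  then show ?thesis
    by (simp add: gradient_def vec_eq_iff inner_axis)
qed

text \<open>Phrased with \<open>has_derivative\<close> because it yields two facts at once: the
  value of the Hessian and the differentiability of the gradient that \<open>C2_on\<close>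
  demands.\<close>

lemma has_derivative_gradient_affine_comp:
  fixes A :: "real^'n^'n"
  assumes C2: "C2_on f U" and y: "A *v y + b \<in> U"
  shows "(gradient (\<lambda>y. f (A *v y + b)) has_derivative
    (\<lambda>v. (transpose A ** hessian f (A *v y + b) ** A) *v v)) (at y)"
proof -
  let ?T = "\<lambda>y. A *v y + b"
  have U: "open U" and df: "\<And>x. x \<in> U \<Longrightarrow> f differentiable (at x)"
    and dg: "\<And>x. x \<in> U \<Longrightarrow> gradient f differentiable (at x)"
    using C2 by (auto simp: C2_on_def differentiable_on_eq_differentiable_at)
  have V: "open (?T -` U)"
    by (intro continuous_open_vimage U continuous_intros
        linear_continuous_at matrix_vector_mul_bounded_linear)
  have "((\<lambda>y. gradient f (?T y)) has_derivative (\<lambda>v. hessian f (?T y) *v (A *v v))) (at y)"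
    using has_derivative_affine_comp[OF dg[OF y]] jacobian_works[THEN iffD1, OF dg[OF y]]
      frechet_derivative_at[of "gradient f" _ "?T y"]
    by (metis (no_types, lifting) ext hessian_def)
  then have "((\<lambda>y. transpose A *v gradient f (?T y)) has_derivative
      (\<lambda>v. transpose A *v (hessian f (?T y) *v (A *v v)))) (at y)"
    by (rule bounded_linear.has_derivative[OF matrix_vector_mul_bounded_linear])
  then have "((\<lambda>y. transpose A *v gradient f (?T y)) has_derivative
      (\<lambda>v. (transpose A ** hessian f (?T y) ** A) *v v)) (at y)"
    by (simp only: matrix_vector_mul_assoc matrix_mul_assoc)
  \<comment> \<open>The gradient formula holds on the whole open preimage of \<open>U\<close>, hence
    near \<open>y\<close>, so both functions have the same derivative at \<open>y\<close>.\<close>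
  then show ?thesis
    by (rule has_derivative_transform_within_open[OF _ V])
      (use y in \<open>auto simp: gradient_affine_comp df\<close>)
qed

lemma hessian_affine_comp:
  fixes A :: "real^'n^'n"
  assumes "C2_on f U" and "A *v y + b \<in> U"
  shows "hessian (\<lambda>y. f (A *v y + b)) y = transpose A ** hessian f (A *v y + b) ** A"
  using frechet_derivative_at[OF has_derivative_gradient_affine_comp[OF assms], symmetric]
  by (simp add: hessian_def jacobian_def)

lemma C2_on_affine_comp:
  fixes A :: "real^'n^'n"
  assumes C2: "C2_on f U"
  shows "C2_on (\<lambda>y. f (A *v y + b)) ((\<lambda>y. A *v y + b) -` U)"
proof -
  let ?T = "\<lambda>y. A *v y + b"
  have U: "open U" and df: "\<And>x. x \<in> U \<Longrightarrow> f differentiable (at x)"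
    and cont: "continuous_on U (hessian f)"
    using C2 by (auto simp: C2_on_def differentiable_on_eq_differentiable_at)
  have V: "open (?T -` U)"
    by (intro continuous_open_vimage U continuous_intros
        linear_continuous_at matrix_vector_mul_bounded_linear)
  have "continuous_on (?T -` U) (\<lambda>y. hessian f (?T y))"
    by (rule continuous_on_compose2[OF cont
          has_derivative_continuous_on[OF has_derivative_at_withinI[OF has_derivative_affine_map]]]) auto
  \<comment> \<open>Entrywise, the product is a finite sum of products of constants with continuous
    entries of the Hessian.\<close>
  then have "continuous_on (?T -` U) (\<lambda>y. transpose A ** hessian f (?T y) ** A)"
    unfolding matrix_matrix_mult_def
    by (intro continuous_on_vec_lambda continuous_intros) (simp_all add: continuous_on_component)
  then have "continuous_on (?T -` U) (hessian (\<lambda>y. f (?T y)))"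
    by (rule continuous_on_eq) (simp add: hessian_affine_comp[OF C2])
  moreover have "(\<lambda>y. f (?T y)) differentiable_on ?T -` U"
    using has_derivative_affine_comp[OF df] V
    by (auto simp: differentiable_on_eq_differentiable_at differentiable_def)
  moreover have "gradient (\<lambda>y. f (?T y)) differentiable_on ?T -` U"
    using has_derivative_gradient_affine_comp[OF C2] V
    by (auto simp: differentiable_on_eq_differentiable_at differentiable_def)
  ultimately show ?thesis
    using V by (simp add: C2_on_def)
qed

lemma convex_hull_affine_image:
  fixes A :: "real^'n^'m"
  shows "convex hull ((\<lambda>y. A *v y + b) ` Y) = (\<lambda>y. A *v y + b) ` (convex hull Y)"
proof -
  have "(\<lambda>y. A *v y + b) ` S = (+) b ` ((*v) A ` S)" for S
    by (auto simp: image_image add.commute)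
  then show ?thesis
    by (simp add: convex_hull_translation convex_hull_linear_image)
qed

lemma convex_on_affine_comp:
  fixes A :: "real^'n^'m"
  assumes g: "convex_on ((\<lambda>y. A *v y + b) ` S) g" and "convex S"
  shows "convex_on S (\<lambda>y. g (A *v y + b))"
proof (rule convex_onI)
  fix t :: real and x y
  assume t: "0 < t" "t < 1" and xy: "x \<in> S" "y \<in> S"
  have "A *v ((1 - t) *\<^sub>R x + t *\<^sub>R y) + b
      = (1 - t) *\<^sub>R (A *v x + b) + t *\<^sub>R (A *v y + b)"
    by (simp add: matrix_vector_right_distrib matrix_vector_mult_scaleR algebra_simps)
  then show "g (A *v ((1 - t) *\<^sub>R x + t *\<^sub>R y) + b)
      \<le> (1 - t) * g (A *v x + b) + t * g (A *v y + b)"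
    using convex_onD[OF g, of t "A *v x + b" "A *v y + b"] t xy by simp
qed fact

lemma DC2_affine_comp:
  fixes A :: "real^'n^'n"
  assumes "(g, h) \<in> DC2 f ((\<lambda>y. A *v y + b) ` Y)"
  shows "((\<lambda>y. g (A *v y + b)), (\<lambda>y. h (A *v y + b))) \<in> DC2 (\<lambda>y. f (A *v y + b)) Y"
proof -
  let ?T = "\<lambda>y. A *v y + b"
  obtain U where U: "?T ` (convex hull Y) \<subseteq> U" "C2_on g U" "C2_on h U" "\<forall>x\<in>U. f x = g x - h x"
    and conv: "convex_on (?T ` (convex hull Y)) g" "convex_on (?T ` (convex hull Y)) h"
    using assms by (auto simp: DC2_def convex_hull_affine_image)
  \<comment> \<open>The preimage of the common neighbourhood \<open>U\<close> serves as the common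
    neighbourhood of the new pair.\<close>
  have "C2_on (\<lambda>y. g (?T y)) (?T -` U)" "C2_on (\<lambda>y. h (?T y)) (?T -` U)"
    using U by (auto intro: C2_on_affine_comp)
  moreover from this have "open (?T -` U)"
    by (simp add: C2_on_def)
  moreover have "convex hull Y \<subseteq> ?T -` U" "\<forall>y\<in>?T -` U. f (?T y) = g (?T y) - h (?T y)"
    using U by auto
  ultimately show ?thesis
    using conv unfolding DC2_def by (blast intro: convex_on_affine_comp convex_convex_hull)
qed

lemma d_dim_affine_comp:
  fixes A :: "real^'n^'n"
  assumes A: "invertible A" and C2: "C2_on g U"
    and U: "convex hull ((\<lambda>y. A *v y + b) ` Y) \<subseteq> U"
  shows "d_dim Y (\<lambda>y. g (A *v y + b)) = d_dim ((\<lambda>y. A *v y + b) ` Y) g"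
proof -
  let ?T = "\<lambda>y. A *v y + b"
  \<comment> \<open>Invertibility acts twice: surjectivity of \<open>A\<close> lets the right factor
    of \<open>transpose A ** H ** A\<close> disappear from the range, and injectivity of
    \<open>transpose A\<close> keeps the dimension of the span.\<close>
  have surj: "range ((*v) A) = UNIV"
    using A invertible_right_inverse matrix_right_invertible_surjective by blast
  have inj: "inj ((*v) (transpose A))"
    using A invertible_left_inverse transpose_invertible matrix_left_invertible_injective by blast
  have "range (\<lambda>v. hessian (\<lambda>y. g (?T y)) z *v v)
      = (*v) (transpose A) ` range (\<lambda>v. hessian g (?T z) *v v)" if "z \<in> convex hull Y" for z
  proof -
    have "?T z \<in> U"
      using that U by (auto simp: convex_hull_affine_image)
    then have "(\<lambda>v. hessian (\<lambda>y. g (?T y)) z *v v)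
        = (*v) (transpose A) \<circ> (*v) (hessian g (?T z)) \<circ> (*v) A"
      by (simp add: hessian_affine_comp[OF C2] fun_eq_iff matrix_vector_mul_assoc matrix_mul_assoc)
    then show ?thesis
      by (metis image_comp surj)
  qed
  then have "V_space Y (\<lambda>y. g (?T y)) = span ((*v) (transpose A) `
      (\<Union>z\<in>convex hull Y. range (\<lambda>v. hessian g (?T z) *v v)))"
    by (simp add: V_space_def image_UN)
  also have "\<dots> = (*v) (transpose A) ` V_space (?T ` Y) g"
    by (simp add: V_space_def convex_hull_affine_image
        linear_span_image[OF matrix_vector_mul_linear] del: transpose_matrix_vector)
  finally show ?thesis
    unfolding d_dim_def by (simp only: dim_image_eq[OF matrix_vector_mul_linear inj_on_subset[OF inj subset_UNIV]])
qed

text \<open>Only one inclusion is proved, for an arbitrary affine bijection; the other one is the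
  instance for the inverse map, with \<open>X\<close> and \<open>Y\<close> exchanged.\<close>

lemma attainable_dims_affine_comp:
  fixes A :: "real^'n^'n"
  assumes "invertible A" and X: "X = (\<lambda>y. A *v y + b) ` Y"
  shows "{d_dim X g |g h. (g, h) \<in> DC2 f X}
    \<subseteq> {d_dim Y g |g h. (g, h) \<in> DC2 (\<lambda>y. f (A *v y + b)) Y}"
proof clarify
  fix g h
  assume gh: "(g, h) \<in> DC2 f X"
  then have "((\<lambda>y. g (A *v y + b)), (\<lambda>y. h (A *v y + b))) \<in> DC2 (\<lambda>y. f (A *v y + b)) Y"
    using DC2_affine_comp X by blast
  moreover have "d_dim X g = d_dim Y (\<lambda>y. g (A *v y + b))"
    using gh d_dim_affine_comp[OF assms(1)] X by (fastforce simp: DC2_def)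
  ultimately show "\<exists>g' h'. d_dim X g = d_dim Y g' \<and> (g', h') \<in> DC2 (\<lambda>y. f (A *v y + b)) Y"
    by blast
qed

theorem proposition3p3:
  fixes X :: "(real^'n) set" and f :: "real^'n \<Rightarrow> real"
    and A :: "real^'n^'n" and b :: "real^'n"
    and Y :: "(real^'n) set" and F :: "real^'n \<Rightarrow> real"
  assumes "compact X"
    and "affine hull X = UNIV"
    and "\<exists>U. open U \<and> convex hull X \<subseteq> U \<and> C2_on f U"
    and "invertible A"
    and "Y = (\<lambda>x. matrix_inv A *v (x - b)) ` X"
    and "F = (\<lambda>y. f (A *v y + b))"
  shows "d_star F Y = d_star f X"
proof -
  let ?B = "matrix_inv A"
  \<comment> \<open>This translation writes the inverse map in the form \<open>?B *v x + ?c\<close>,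
    to which the lemma on attainable dimensions applies.\<close>
  let ?c = "- (?B *v b)"
  have AB: "A ** ?B = mat 1" and BA: "?B ** A = mat 1"
    using someI_ex[OF assms(4)[unfolded invertible_def]] by (simp_all add: matrix_inv_def)
  then have invB: "invertible ?B"
    by (auto simp: invertible_def)
  have Y: "Y = (\<lambda>x. ?B *v x + ?c) ` X"
    by (simp add: assms(5) matrix_vector_mult_diff_distrib)
  have T: "A *v (?B *v x + ?c) + b = x" for x
    by (simp add: matrix_vector_right_distrib matrix_vector_mult_diff_distrib
        matrix_vector_mul_assoc AB)
  have X: "X = (\<lambda>y. A *v y + b) ` Y"
    by (simp only: Y image_image T image_ident)
  have f: "f = (\<lambda>x. F (?B *v x + ?c))"
    by (simp only: assms(6) T)
  have "{d_dim X g |g h. (g, h) \<in> DC2 f X} = {d_dim Y g |g h. (g, h) \<in> DC2 F Y}"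
    using attainable_dims_affine_comp[OF assms(4) X, of f]
      attainable_dims_affine_comp[OF invB Y, of F]
    by (simp only: assms(6)[symmetric] f[symmetric] subset_antisym)
  then have "k \<in> {d_dim X g |g h. (g, h) \<in> DC2 f X} \<longleftrightarrow> k \<in> {d_dim Y g |g h. (g, h) \<in> DC2 F Y}" for k
    by simp
  \<comment> \<open>These are the predicates under \<open>LEAST\<close>; since they agree for every
    \<open>k\<close>, the minima agree without a minimizing pair being exhibited.\<close>
  then have "(\<exists>(g, h)\<in>DC2 f X. k = d_dim X g) \<longleftrightarrow> (\<exists>(g, h)\<in>DC2 F Y. k = d_dim Y g)" for k
    by (fastforce simp: Bex_def)
  then show ?thesis
    by (simp add: d_star_def)
qed

end
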